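(* (a) Let $f\in\mathcal{HK}$ and $g\in\mathcal{BV}$. Then $f\ast g$ exists on $\mathbb{R}$ and $|f\ast g(x)|\le\|f\|\left[\inf|g|+Vg\right]$ for all $x\in\mathbb{R}$. (b) Let $f\in\mathcal{HK}_{loc}$ and $g\in\mathcal{BV}$ with the support of $g$ in the compact interval $[a,b]$. Then $f\ast g$ exists on $\mathbb{R}$ and, for all $x\in\mathbb{R}$, $$|f\ast g(x)|\le\left|\int_{x-b}^{x-a}f\right|\inf_{[a,b]}|g|+\|f\|_{[x-b,x-a]}V_{[a,b]}g.$$
   Context: Functions are real-valued on $\mathbb{R}$ and all integrals are Henstock--Kurzweil integrals. $\mathcal{HK}$ is the set of Henstock--Kurzweil integrable functions on $\mathbb{R}$; $\mathcal{HK}_{loc}$ the functions Henstock--Kurzweil integrable over every compact interval; $\mathcal{BV}$ the functions of bounded variation on $\mathbb{R}$. $V_Ag$ is the variation of $g$ over $A$, with $Vg=V_{\mathbb{R}}g$. The Alexiewicz norm is $\|f\|_A=\sup_{I\subset A}\left|\int_If\right|$, the supremum being over all intervals $I\subset A$; $\|f\|=\|f\|_{\mathbb{R}}$. $\inf|g|$ is the infimum over $\mathbb{R}$. The convolution is $f\ast g(x)=\int_{-\infty}^\infty f(x-t)g(t)\,dt$. *)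

theory Defs
  imports "HOL-Analysis.Analysis"
begin

text \<open>
  The library's \<open>integrable_on\<close> and \<open>integral\<close> are the Henstock--Kurzweil notions. Over \<open>UNIV\<close> they
  are defined by the limit over growing compact boxes, whose two endpoints move independently; by
  Hake's theorem this is the Henstock--Kurzweil integral over the (extended) real line.
\<close>

definition HK :: "(real \<Rightarrow> real) set" where
  "HK = {f. f integrable_on UNIV}"

definition HK_loc :: "(real \<Rightarrow> real) set" where
  "HK_loc = {f. \<forall>c d. f integrable_on {c..d}}"

text \<open>
  The supremum ranges over all intervals, bounded or not, degenerate or not. It is a supremum of
  reals, hence only meaningful when the set is bounded above; this is the case for \<open>f \<in> HK\<close>, and for
  \<open>f \<in> HK_loc\<close> when \<open>A\<close> is bounded.
\<close>

definition alexiewicz_norm :: "real set \<Rightarrow> (real \<Rightarrow> real) \<Rightarrow> real" where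
  "alexiewicz_norm A f = (SUP I\<in>{I. is_interval I \<and> I \<subseteq> A}. \<bar>integral I f\<bar>)"

definition variation_sums :: "real set \<Rightarrow> (real \<Rightarrow> real) \<Rightarrow> real set" where
  "variation_sums A g =
     {\<Sum>i<n. \<bar>g (p (Suc i)) - g (p i)\<bar> | (n :: nat) p. mono_on {..n} p \<and> p ` {..n} \<subseteq> A}"

definition bounded_variation_on :: "real set \<Rightarrow> (real \<Rightarrow> real) \<Rightarrow> bool" where
  "bounded_variation_on A g \<longleftrightarrow> bdd_above (variation_sums A g)"

text \<open>As a supremum of reals, only meaningful if \<open>A \<noteq> {}\<close> and \<open>bounded_variation_on A g\<close>.\<close>

definition variation :: "real set \<Rightarrow> (real \<Rightarrow> real) \<Rightarrow> real" where
  "variation A g = Sup (variation_sums A g)"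

definition BV :: "(real \<Rightarrow> real) set" where
  "BV = {g. bounded_variation_on UNIV g}"

definition convolution_exists_at :: "(real \<Rightarrow> real) \<Rightarrow> (real \<Rightarrow> real) \<Rightarrow> real \<Rightarrow> bool" where
  "convolution_exists_at f g x \<longleftrightarrow> (\<lambda>t. f (x - t) * g t) integrable_on UNIV"

definition convolution :: "(real \<Rightarrow> real) \<Rightarrow> (real \<Rightarrow> real) \<Rightarrow> real \<Rightarrow> real" where
  "convolution f g x = integral UNIV (\<lambda>t. f (x - t) * g t)"

end

theory Submission
  imports Defs
begin

text \<open>
  Put \<open>F t = f (x - t)\<close>, whose integral over \<open>{s..t}\<close> is that of \<open>f\<close> over \<open>{x - t..x - s}\<close>.
  Everything rests on one estimate over a compact interval, \<open>integral_mult_BV_compact\<close>: if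
  \<open>c \<in> {a..b}\<close> and \<open>M\<close> bounds the integrals of \<open>F\<close> over all subintervals, then
  \<open>\<bar>\<integral> F g\<bar> \<le> \<bar>\<integral> F\<bar> * \<bar>g c\<bar> + M * variation {a..b} g\<close>.
  The signed variation \<open>V t\<close> of \<open>g\<close> counted from \<open>c\<close> gives the Jordan decomposition
  \<open>g = g c + P - N\<close>, where \<open>P = (V + (g - g c)) / 2\<close> and \<open>N = (V - (g - g c)) / 2\<close> are increasing
  and vanish at \<open>c\<close>. By the second mean value theorem an increasing \<open>h\<close> that vanishes inside the
  interval contributes at most \<open>M * (\<bar>h a\<bar> + \<bar>h b\<bar>) = M * (h b - h a)\<close>, and the increments of \<open>P\<close>
  and \<open>N\<close> add up to that of \<open>V\<close>. This takes the place of integration by parts with a Stieltjes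
  integral. That \<open>V\<close> dominates the increments of \<open>g\<close> is the superadditivity of the variation.

  If \<open>g\<close> is supported in \<open>{a..b}\<close>, the estimate is applied to that interval; minimising over \<open>c\<close>
  gives the infimum of \<open>\<bar>g\<bar>\<close> (\<open>le_mult_INF_abs_add\<close>).

  On the whole line, integrability amounts to local integrability together with uniformly small
  integrals over intervals far from the origin (\<open>integrable_on_UNIV_iff_small_tails\<close>). The same
  estimate on such intervals, \<open>g\<close> being bounded, transfers this property from \<open>F\<close> to \<open>F g\<close>, and its
  bound survives the limit of growing compact intervals.
\<close>

section \<open>Variation is superadditive\<close>

lemma variation_sums_concat:
  fixes A B C :: "real set"
  assumes u: "u \<in> variation_sums A g" and v: "v \<in> variation_sums B g"
    and AB: "\<And>x y. x \<in> A \<Longrightarrow> y \<in> B \<Longrightarrow> x \<le> y" and sub: "A \<union> B \<subseteq> C"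
  shows "\<exists>w\<in>variation_sums C g. u + v \<le> w"
proof -
  obtain n p where p: "mono_on {..n::nat} p" "p ` {..n} \<subseteq> A"
      "u = (\<Sum>i<n. \<bar>g (p (Suc i)) - g (p i)\<bar>)"
    using u by (auto simp: variation_sums_def)
  obtain m q where q: "mono_on {..m::nat} q" "q ` {..m} \<subseteq> B"
      "v = (\<Sum>i<m. \<bar>g (q (Suc i)) - g (q i)\<bar>)"
    using v by (auto simp: variation_sums_def)
  define r where "r i = (if i \<le> n then p i else q (i - Suc n))" for i
  define w where "w = (\<Sum>i<Suc n + m. \<bar>g (r (Suc i)) - g (r i)\<bar>)"
  have r_mem: "r ` {..Suc n + m} \<subseteq> C"
  proof
    fix y assume "y \<in> r ` {..Suc n + m}"
    then obtain i where i: "i \<le> Suc n + m" "y = r i" by auto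
    show "y \<in> C"
    proof (cases "i \<le> n")
      case True
      then show ?thesis using i p(2) sub by (auto simp: r_def)
    next
      case False
      then have "i - Suc n \<le> m" using i by auto
      then show ?thesis using i q(2) sub False by (auto simp: r_def)
    qed
  qed
  have r_mono: "mono_on {..Suc n + m} r"
  proof (rule mono_onI)
    fix i j assume ij: "i \<in> {..Suc n + m}" "j \<in> {..Suc n + m}" "i \<le> j"
    consider "j \<le> n" | "i \<le> n" "n < j" | "n < i" using ij by linarith
    then show "r i \<le> r j"
    proof cases
      case 1
      then show ?thesis using ij p(1) by (auto simp: r_def intro: mono_onD)
    next
      case 2
      then have "p i \<in> A" "q (j - Suc n) \<in> B" using ij p(2) q(2) by auto
      then show ?thesis using 2 AB by (auto simp: r_def)
    next
      case 3
      then show ?thesis using ij by (auto simp: r_def intro!: mono_onD[OF q(1)])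
    qed
  qed
  have "w \<in> variation_sums C g"
    unfolding w_def variation_sums_def using r_mem r_mono by blast
  moreover have "u + v \<le> w"
  proof -
    have sum_split: "(\<Sum>i<k + l. d i) = (\<Sum>i<k. d i) + (\<Sum>i<l. d (k + i))"
      for k l and d :: "nat \<Rightarrow> real"
      by (induction l) simp_all
    have "w = (\<Sum>i<Suc n. \<bar>g (r (Suc i)) - g (r i)\<bar>)
              + (\<Sum>i<m. \<bar>g (r (Suc (Suc n + i))) - g (r (Suc n + i))\<bar>)"
      unfolding w_def by (rule sum_split)
    moreover have "(\<Sum>i<n. \<bar>g (r (Suc i)) - g (r i)\<bar>) = u"
      unfolding p(3) by (intro sum.cong) (auto simp: r_def)
    moreover have "(\<Sum>i<m. \<bar>g (r (Suc (Suc n + i))) - g (r (Suc n + i))\<bar>) = v"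
      unfolding q(3) by (intro sum.cong) (auto simp: r_def)
    ultimately show ?thesis by simp
  qed
  ultimately show ?thesis by blast
qed

lemma zero_in_variation_sums:
  assumes "A \<noteq> {}"
  shows "0 \<in> variation_sums A g"
proof -
  obtain x where "x \<in> A" using assms by blast
  then show ?thesis
    unfolding variation_sums_def
    by (auto intro!: exI[of _ "0::nat"] exI[of _ "\<lambda>_. x"] simp: monotone_on_def)
qed

lemma bounded_variation_on_subset:
  assumes "bounded_variation_on B g" "A \<subseteq> B"
  shows "bounded_variation_on A g"
proof -
  have "variation_sums A g \<subseteq> variation_sums B g"
    unfolding variation_sums_def using assms(2) by blast
  then show ?thesis
    using assms(1) unfolding bounded_variation_on_def by (rule bdd_above_mono[rotated])
qed

lemma variation_mono:
  assumes "bounded_variation_on B g" "A \<subseteq> B" "A \<noteq> {}"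
  shows "variation A g \<le> variation B g"
proof -
  have "variation_sums A g \<subseteq> variation_sums B g"
    unfolding variation_sums_def using assms(2) by blast
  then show ?thesis
    using assms zero_in_variation_sums[of A g] unfolding variation_def bounded_variation_on_def
    by (intro cSup_subset_mono) auto
qed

lemma variation_nonneg:
  assumes "bounded_variation_on A g" "A \<noteq> {}"
  shows "0 \<le> variation A g"
  using assms zero_in_variation_sums[of A g] unfolding variation_def bounded_variation_on_def
  by (intro cSup_upper) auto

text \<open>
  The gap between the last point taken from the left set and the first point taken from the right
  set only adds a nonnegative term, which is why equality is not to be expected for general sets.
\<close>

lemma variation_superadditive:
  fixes A B C :: "real set"
  assumes bv: "bounded_variation_on C g" and "A \<noteq> {}" "B \<noteq> {}"
    and AB: "\<And>x y. x \<in> A \<Longrightarrow> y \<in> B \<Longrightarrow> x \<le> y" and sub: "A \<union> B \<subseteq> C"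
  shows "variation A g + variation B g \<le> variation C g"
proof -
  have sum_le: "u + v \<le> variation C g" if "u \<in> variation_sums A g" "v \<in> variation_sums B g" for u v
    using variation_sums_concat[OF that AB sub] bv
    by (auto simp: variation_def bounded_variation_on_def intro: cSup_upper2)
  have "variation A g \<le> variation C g - v" if "v \<in> variation_sums B g" for v
    unfolding variation_def[of A]
    by (rule cSup_least) (use sum_le that zero_in_variation_sums[OF assms(2), of g] in \<open>auto simp: algebra_simps\<close>)
  then have "variation B g \<le> variation C g - variation A g"
    unfolding variation_def[of B]
    by (intro cSup_least) (use zero_in_variation_sums[OF assms(3), of g] in \<open>auto simp: algebra_simps\<close>)
  then show ?thesis by simp
qed

lemma abs_diff_le_variation:
  assumes bv: "bounded_variation_on {s..t} g" and "s \<le> t"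
  shows "\<bar>g t - g s\<bar> \<le> variation {s..t} g"
proof -
  have "\<bar>g t - g s\<bar> \<in> variation_sums {s..t} g"
    unfolding variation_sums_def using \<open>s \<le> t\<close>
    by (auto intro!: exI[of _ "1::nat"] exI[of _ "\<lambda>i. if i = 0 then s else t"] simp: monotone_on_def)
  then show ?thesis
    using bv unfolding variation_def bounded_variation_on_def by (intro cSup_upper)
qed

section \<open>Integrating against a function of bounded variation over a compact interval\<close>

text \<open>
  A zero of \<open>h\<close> forces \<open>h a \<le> 0 \<le> h b\<close>, so the two endpoint weights \<open>\<bar>h a\<bar>\<close> and \<open>\<bar>h b\<bar>\<close> of the second
  mean value theorem add up to exactly the increment of \<open>h\<close>.
\<close>

lemma integral_mult_mono_compact:
  fixes f h :: "real \<Rightarrow> real"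
  assumes f: "f integrable_on {a..b}" and c: "a \<le> c" "c \<le> b"
    and h: "\<And>s t. a \<le> s \<Longrightarrow> s \<le> t \<Longrightarrow> t \<le> b \<Longrightarrow> h s \<le> h t" and "h c = 0"
    and M: "\<And>s t. a \<le> s \<Longrightarrow> s \<le> t \<Longrightarrow> t \<le> b \<Longrightarrow> \<bar>integral {s..t} f\<bar> \<le> M"
  shows "(\<lambda>t. f t * h t) integrable_on {a..b}"
    and "\<bar>integral {a..b} (\<lambda>t. f t * h t)\<bar> \<le> M * (h b - h a)"
proof -
  have "a \<le> b" using c by simp
  then obtain \<xi> where \<xi>: "\<xi> \<in> {a..b}"
    "((\<lambda>t. h t * f t) has_integral (h a * integral {a..\<xi>} f + h b * integral {\<xi>..b} f)) {a..b}"
    using second_mean_value_theorem_full[of f a b h] f h by blast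
  then have I: "((\<lambda>t. f t * h t) has_integral (h a * integral {a..\<xi>} f + h b * integral {\<xi>..b} f)) {a..b}"
    by (simp add: mult.commute)
  then show "(\<lambda>t. f t * h t) integrable_on {a..b}" by blast
  have sign: "h a \<le> 0" "0 \<le> h b" using h[of a c] h[of c b] c \<open>h c = 0\<close> by auto
  have "\<bar>integral {a..b} (\<lambda>t. f t * h t)\<bar>
      \<le> \<bar>h a\<bar> * \<bar>integral {a..\<xi>} f\<bar> + \<bar>h b\<bar> * \<bar>integral {\<xi>..b} f\<bar>"
    unfolding integral_unique[OF I] by (metis abs_mult abs_triangle_ineq)
  also have "\<dots> \<le> \<bar>h a\<bar> * M + \<bar>h b\<bar> * M"
    using \<xi>(1) M[of a \<xi>] M[of \<xi> b] by (intro add_mono mult_left_mono) auto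
  also have "\<dots> = M * (h b - h a)" using sign by (simp add: algebra_simps)
  finally show "\<bar>integral {a..b} (\<lambda>t. f t * h t)\<bar> \<le> M * (h b - h a)" .
qed

text \<open>
  Subtracting the value \<open>g c\<close> at an arbitrary point costs \<open>\<bar>\<integral> f\<bar> * \<bar>g c\<bar>\<close>; what remains is split into
  increasing functions that vanish at \<open>c\<close>. The freedom in \<open>c\<close> is what later produces the infimum
  of \<open>\<bar>g\<bar>\<close>, and the constant 1 in front of the variation relies on \<open>P\<close> and \<open>N\<close> having the smallest
  possible total increment.
\<close>

lemma integral_mult_BV_compact:
  fixes f g :: "real \<Rightarrow> real"
  assumes f: "f integrable_on {a..b}" and c: "a \<le> c" "c \<le> b"
    and bv: "bounded_variation_on {a..b} g"
    and M: "\<And>s t. a \<le> s \<Longrightarrow> s \<le> t \<Longrightarrow> t \<le> b \<Longrightarrow> \<bar>integral {s..t} f\<bar> \<le> M"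
  shows "(\<lambda>t. f t * g t) integrable_on {a..b}"
    and "\<bar>integral {a..b} (\<lambda>t. f t * g t)\<bar>
           \<le> \<bar>integral {a..b} f\<bar> * \<bar>g c\<bar> + M * variation {a..b} g"
proof -
  define V where "V t = variation {a..t} g - variation {a..c} g" for t
  define P where "P t = (V t + (g t - g c)) / 2" for t
  define N where "N t = (V t - (g t - g c)) / 2" for t
  have V_incr: "\<bar>g t - g s\<bar> \<le> V t - V s" if "a \<le> s" "s \<le> t" "t \<le> b" for s t
  proof -
    have "\<bar>g t - g s\<bar> \<le> variation {s..t} g"
      using that by (intro abs_diff_le_variation bounded_variation_on_subset[OF bv]) auto
    moreover have "variation {a..s} g + variation {s..t} g \<le> variation {a..t} g"
      using that by (intro variation_superadditive bounded_variation_on_subset[OF bv]) auto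
    ultimately show ?thesis by (simp add: V_def)
  qed
  have P_mono: "P s \<le> P t" and N_mono: "N s \<le> N t" if "a \<le> s" "s \<le> t" "t \<le> b" for s t
    using V_incr[OF that] by (auto simp: P_def N_def abs_le_iff)
  have zero: "P c = 0" "N c = 0" by (auto simp: P_def N_def V_def)
  have P: "(\<lambda>t. f t * P t) integrable_on {a..b}"
      "\<bar>integral {a..b} (\<lambda>t. f t * P t)\<bar> \<le> M * (P b - P a)"
    by (rule integral_mult_mono_compact[of f a b c]; fact f c P_mono zero M)+
  have N: "(\<lambda>t. f t * N t) integrable_on {a..b}"
      "\<bar>integral {a..b} (\<lambda>t. f t * N t)\<bar> \<le> M * (N b - N a)"
    by (rule integral_mult_mono_compact[of f a b c]; fact f c N_mono zero M)+
  have PN: "f t * g t = g c * f t + f t * P t - f t * N t" for t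
    by (simp add: P_def N_def field_simps)
  have I: "((\<lambda>t. f t * g t) has_integral (g c * integral {a..b} f
      + integral {a..b} (\<lambda>t. f t * P t) - integral {a..b} (\<lambda>t. f t * N t))) {a..b}"
    unfolding PN
    by (intro has_integral_add has_integral_diff has_integral_mult_right integrable_integral f P(1) N(1))
  then show "(\<lambda>t. f t * g t) integrable_on {a..b}" by blast
  have "0 \<le> M" using M[of a a] c by simp
  have "\<bar>integral {a..b} (\<lambda>t. f t * g t)\<bar>
      \<le> \<bar>g c * integral {a..b} f\<bar> + \<bar>integral {a..b} (\<lambda>t. f t * P t)\<bar> + \<bar>integral {a..b} (\<lambda>t. f t * N t)\<bar>"
    unfolding integral_unique[OF I] by linarith
  also have "\<dots> \<le> \<bar>g c * integral {a..b} f\<bar> + M * (P b - P a) + M * (N b - N a)"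
    using P(2) N(2) by simp
  also have "\<dots> = \<bar>integral {a..b} f\<bar> * \<bar>g c\<bar> + M * (V b - V a)"
    by (simp add: P_def N_def abs_mult field_simps)
  also have "\<dots> \<le> \<bar>integral {a..b} f\<bar> * \<bar>g c\<bar> + M * variation {a..b} g"
    using variation_nonneg[of "{a..a}" g] bounded_variation_on_subset[OF bv, of "{a..a}"] c \<open>0 \<le> M\<close>
    by (intro add_left_mono mult_left_mono) (auto simp: V_def)
  finally show "\<bar>integral {a..b} (\<lambda>t. f t * g t)\<bar>
           \<le> \<bar>integral {a..b} f\<bar> * \<bar>g c\<bar> + M * variation {a..b} g" .
qed

section \<open>Passing from compact intervals to the line\<close>

text \<open>
  A Cauchy criterion for the improper integral that speaks only of integrals of \<open>f\<close> over compact
  intervals. It is therefore easy to transport along reflections, translations and multiplication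
  by a function of bounded variation.
\<close>

lemma integrable_on_UNIV_iff_small_tails:
  fixes f :: "real \<Rightarrow> real"
  shows "f integrable_on UNIV \<longleftrightarrow>
    (\<forall>s t. f integrable_on {s..t}) \<and>
    (\<forall>e>0. \<exists>B. \<forall>s t. s \<le> t \<longrightarrow> B \<le> s \<or> t \<le> - B \<longrightarrow> \<bar>integral {s..t} f\<bar> \<le> e)"
    (is "_ \<longleftrightarrow> _ \<and> ?tails")
proof
  assume f: "f integrable_on UNIV"
  have loc: "f integrable_on {s..t}" for s t
    using integrable_on_subinterval[OF f] by blast
  have ?tails
  proof (intro allI impI)
    fix e :: real assume "e > 0"
    then obtain B where "B > 0" and B: "\<And>a b c d. ball 0 B \<subseteq> {a..b} \<Longrightarrow> ball 0 B \<subseteq> {c..d} \<Longrightarrow>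
        \<bar>integral {a..b} f - integral {c..d} f\<bar> < e"
      using f[unfolded integrable_alt[of f UNIV]] by (auto simp: ball_eq_greaterThanLessThan)
    have ball: "ball 0 B \<subseteq> {a..b}" if "a \<le> - B" "B \<le> b" for a b
      using that by (auto simp: dist_real_def)
    have "\<bar>integral {s..t} f\<bar> \<le> e" if st: "s \<le> t" "B \<le> s \<or> t \<le> - B" for s t
      using st(2)
    proof
      assume "B \<le> s"
      then have "integral {-B..s} f + integral {s..t} f = integral {-B..t} f"
        using st \<open>B > 0\<close> by (intro Henstock_Kurzweil_Integration.integral_combine loc) auto
      moreover have "\<bar>integral {-B..t} f - integral {-B..s} f\<bar> < e"
        using st \<open>B \<le> s\<close> by (intro B ball) auto
      ultimately show ?thesis by simp
    next
      assume "t \<le> - B"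
      then have "integral {s..t} f + integral {t..B} f = integral {s..B} f"
        using st \<open>B > 0\<close> by (intro Henstock_Kurzweil_Integration.integral_combine loc) auto
      moreover have "\<bar>integral {s..B} f - integral {t..B} f\<bar> < e"
        using st \<open>t \<le> - B\<close> by (intro B ball) auto
      ultimately show ?thesis by simp
    qed
    then show "\<exists>B. \<forall>s t. s \<le> t \<longrightarrow> B \<le> s \<or> t \<le> - B \<longrightarrow> \<bar>integral {s..t} f\<bar> \<le> e" by blast
  qed
  with loc show "(\<forall>s t. f integrable_on {s..t}) \<and> ?tails" by blast
next
  assume R: "(\<forall>s t. f integrable_on {s..t}) \<and> ?tails"
  then have loc: "f integrable_on {s..t}" for s t by blast
  have "\<exists>B>0. \<forall>a b c d. ball 0 B \<subseteq> {a..b} \<and> ball 0 B \<subseteq> {c..d} \<longrightarrow>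
      \<bar>integral {a..b} f - integral {c..d} f\<bar> < e" if "e > 0" for e
  proof -
    \<comment> \<open>Two integrals over large intervals differ by at most four tails, hence the fifth of \<open>e\<close>.\<close>
    have "e / 5 > 0" using that by simp
    then obtain B0 where B0: "\<And>s t. s \<le> t \<Longrightarrow> B0 \<le> s \<or> t \<le> - B0 \<Longrightarrow> \<bar>integral {s..t} f\<bar> \<le> e / 5"
      using R by blast
    define B where "B = max B0 1"
    have "B > 0" by (simp add: B_def)
    have core: "\<bar>integral {a..b} f - integral {-B..B} f\<bar> \<le> 2 * (e / 5)" if "ball 0 B \<subseteq> {a..b}" for a b
    proof -
      have "{-B<..<B} \<subseteq> {a..b}" using that by (simp add: ball_eq_greaterThanLessThan)
      then have ab: "a \<le> - B" "B \<le> b"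
        using \<open>B > 0\<close> by (auto simp: greaterThanLessThan_subseteq_atLeastAtMost_iff)
      have "integral {a..-B} f + integral {-B..b} f = integral {a..b} f"
        using ab \<open>B > 0\<close> by (intro Henstock_Kurzweil_Integration.integral_combine loc) auto
      moreover have "integral {-B..B} f + integral {B..b} f = integral {-B..b} f"
        using ab \<open>B > 0\<close> by (intro Henstock_Kurzweil_Integration.integral_combine loc) auto
      moreover have "\<bar>integral {a..-B} f\<bar> \<le> e / 5" "\<bar>integral {B..b} f\<bar> \<le> e / 5"
        using ab B0[of a "-B"] B0[of B b] by (simp_all add: B_def)
      ultimately show ?thesis by linarith
    qed
    have "\<bar>integral {a..b} f - integral {c..d} f\<bar> < e"
      if "ball 0 B \<subseteq> {a..b}" "ball 0 B \<subseteq> {c..d}" for a b c d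
      using core[OF that(1)] core[OF that(2)] \<open>e > 0\<close> by linarith
    then show ?thesis using \<open>B > 0\<close> by blast
  qed
  then show "f integrable_on UNIV"
    unfolding integrable_alt[of f UNIV] using loc by simp
qed

lemma abs_integral_UNIV_le:
  fixes f :: "real \<Rightarrow> real"
  assumes f: "f integrable_on UNIV" and K: "\<And>r. r0 \<le> r \<Longrightarrow> \<bar>integral {-r..r} f\<bar> \<le> K"
  shows "\<bar>integral UNIV f\<bar> \<le> K"
proof (rule field_le_epsilon)
  fix e :: real assume "e > 0"
  have "\<forall>e>0. \<exists>B>0. \<forall>a b. ball 0 B \<subseteq> {a..b} \<longrightarrow>
      (\<exists>z. (f has_integral z) {a..b} \<and> \<bar>z - integral UNIV f\<bar> < e)"
    using integrable_integral[OF f, unfolded has_integral'[of f _ UNIV]] by simp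
  from this[rule_format, OF \<open>e > 0\<close>] obtain B where B: "\<And>a b. ball 0 B \<subseteq> {a..b} \<Longrightarrow>
      \<exists>z. (f has_integral z) {a..b} \<and> \<bar>z - integral UNIV f\<bar> < e"
    by blast
  define r where "r = max r0 B"
  have "ball 0 B \<subseteq> {-r..r}"
    unfolding r_def by (auto simp: dist_real_def)
  then obtain z where z: "(f has_integral z) {-r..r}" "\<bar>z - integral UNIV f\<bar> < e"
    using B[of "-r" r] by blast
  have "\<bar>z\<bar> \<le> K"
    using K[of r] unfolding integral_unique[OF z(1)] by (simp add: r_def)
  with z(2) show "\<bar>integral UNIV f\<bar> \<le> K + e" by linarith
qed

text \<open>
  The Alexiewicz norm ranges over intervals of every shape, whereas the estimates concern closed
  bounded ones. An interval differs from its closure by a null set, and the integral over an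
  unbounded interval is a limit of integrals over bounded ones.
\<close>

lemma integral_bounded_interval_eq_compact:
  fixes f :: "real \<Rightarrow> real" and I :: "real set"
  assumes "is_interval I" "bounded I"
  obtains s t where "{s..t} = closure I" "integral I f = integral {s..t} f"
proof -
  have "convex I" using assms(1) by (simp only: is_interval_convex_1)
  then have "is_interval (closure I)"
    unfolding is_interval_convex_1 by (rule convex_closure)
  moreover have "compact (closure I)"
    using assms(2) by (simp only: compact_closure)
  ultimately obtain s t where "closure I = cbox s t"
    using is_interval_compact[of "closure I"] by blast
  then have st: "closure I = {s..t}" by (simp only: box_real)
  have "negligible (frontier I)"
    using \<open>convex I\<close> by (rule negligible_convex_frontier)
  moreover have "closure I - I \<subseteq> frontier I"
    using interior_subset[of I] unfolding frontier_def by blast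
  ultimately have "negligible (closure I - I)"
    by (rule negligible_subset)
  then have "integral I f = integral (closure I) f"
    by (intro integral_subset_negligible closure_subset)
  then show thesis
    unfolding st by (rule that[OF st[symmetric]])
qed

lemma abs_integral_interval_le:
  fixes f :: "real \<Rightarrow> real" and I :: "real set"
  assumes I: "is_interval I" and "0 \<le> K"
    and K: "\<And>s t. s \<le> t \<Longrightarrow> {s..t} \<subseteq> closure I \<Longrightarrow> \<bar>integral {s..t} f\<bar> \<le> K"
  shows "\<bar>integral I f\<bar> \<le> K"
proof (cases "f integrable_on I")
  case True
  define h where "h x = (if x \<in> I then f x else 0)" for x
  have bound: "\<bar>integral {-r..r} h\<bar> \<le> K" if "0 \<le> r" for r
  proof -
    have "is_interval (I \<inter> {-r..r})" "bounded (I \<inter> {-r..r})"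
      using I by (simp_all add: is_interval_Int is_interval_cc bounded_Int)
    then obtain s t where st: "{s..t} = closure (I \<inter> {-r..r})"
        "integral (I \<inter> {-r..r}) f = integral {s..t} f"
      by (rule integral_bounded_interval_eq_compact)
    have "{s..t} \<subseteq> closure I" unfolding st(1) by (intro closure_mono) auto
    then have "\<bar>integral {s..t} f\<bar> \<le> K"
      using \<open>0 \<le> K\<close> by (cases "s \<le> t") (rule K, simp_all)
    then show ?thesis
      unfolding h_def Henstock_Kurzweil_Integration.integral_restrict_Int st(2) .
  qed
  have "h integrable_on UNIV"
    unfolding h_def using True by (simp add: Henstock_Kurzweil_Integration.integrable_restrict_UNIV)
  then have "\<bar>integral UNIV h\<bar> \<le> K" using bound by (rule abs_integral_UNIV_le)
  then show ?thesis
    unfolding h_def by (simp add: Henstock_Kurzweil_Integration.integral_restrict_UNIV)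
  \<comment> \<open>The integral of a function that is not integrable has the default value 0.\<close>
qed (use \<open>0 \<le> K\<close> in \<open>simp add: not_integrable_integral\<close>)

section \<open>The Alexiewicz norm\<close>

text \<open>
  A supremum of reals is an upper bound only for a set that is bounded above; the bound \<open>K\<close> over
  compact intervals ensures this for the larger family of all intervals in \<open>A\<close>.
\<close>

lemma abs_integral_le_alexiewicz_norm:
  fixes f :: "real \<Rightarrow> real"
  assumes "closed A" and K: "\<And>s t. s \<le> t \<Longrightarrow> {s..t} \<subseteq> A \<Longrightarrow> \<bar>integral {s..t} f\<bar> \<le> K"
    and "{s..t} \<subseteq> A"
  shows "\<bar>integral {s..t} f\<bar> \<le> alexiewicz_norm A f"
proof -
  have "\<bar>integral I f\<bar> \<le> max K 0" if "is_interval I" "I \<subseteq> A" for I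
  proof (rule abs_integral_interval_le[OF that(1)])
    have "closure I \<subseteq> A" using that(2) \<open>closed A\<close> by (rule closure_minimal)
    then show "\<bar>integral {s..t} f\<bar> \<le> max K 0" if "s \<le> t" "{s..t} \<subseteq> closure I" for s t
      using K[of s t] that by force
  qed simp
  then have "bdd_above ((\<lambda>I. \<bar>integral I f\<bar>) ` {I. is_interval I \<and> I \<subseteq> A})"
    by (intro bdd_aboveI2[where M="max K 0"]) auto
  then show ?thesis
    unfolding alexiewicz_norm_def using \<open>{s..t} \<subseteq> A\<close> by (intro cSUP_upper) auto
qed

lemma compact_interval_integrals_bounded:
  fixes f :: "real \<Rightarrow> real"
  assumes f: "f integrable_on {a..b}"
  obtains K where "\<And>s t. s \<le> t \<Longrightarrow> {s..t} \<subseteq> {a..b} \<Longrightarrow> \<bar>integral {s..t} f\<bar> \<le> K"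
proof -
  have "bounded ((\<lambda>x. integral {a..x} f) ` {a..b})"
    by (intro compact_imp_bounded compact_continuous_image indefinite_integral_continuous_1 f compact_Icc)
  then obtain C where "\<forall>y\<in>(\<lambda>x. integral {a..x} f) ` {a..b}. norm y \<le> C"
    unfolding bounded_iff by blast
  then have C: "\<bar>integral {a..x} f\<bar> \<le> C" if "x \<in> {a..b}" for x
    using that by simp
  have "\<bar>integral {s..t} f\<bar> \<le> 2 * C" if "s \<le> t" "{s..t} \<subseteq> {a..b}" for s t
  proof -
    have st: "a \<le> s" "t \<le> b" using that by auto
    have "integral {a..s} f + integral {s..t} f = integral {a..t} f"
      using st that(1)
      by (intro Henstock_Kurzweil_Integration.integral_combine integrable_on_subinterval[OF f]) auto
    then show ?thesis using C[of s] C[of t] st that(1) by auto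
  qed
  then show thesis by (rule that)
qed

text \<open>
  An interval is cut at two points \<open>-B\<close> and \<open>B\<close> into a central part, whose integral is bounded by
  continuity of the indefinite integral, and two tails, whose integrals are at most 1.
\<close>

lemma HK_interval_integrals_bounded:
  fixes f :: "real \<Rightarrow> real"
  assumes f: "f integrable_on UNIV"
  obtains K where "\<And>s t. s \<le> t \<Longrightarrow> \<bar>integral {s..t} f\<bar> \<le> K"
proof -
  have loc: "f integrable_on {s..t}" for s t
    using integrable_on_subinterval[OF f] by blast
  obtain B0 where B0: "\<And>s t. s \<le> t \<Longrightarrow> B0 \<le> s \<or> t \<le> - B0 \<Longrightarrow> \<bar>integral {s..t} f\<bar> \<le> 1"
    using f[unfolded integrable_on_UNIV_iff_small_tails] zero_less_one by blast
  define B where "B = max B0 1"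
  have tail: "\<bar>integral {s..t} f\<bar> \<le> 1" if "B \<le> s \<or> t \<le> - B" for s t
  proof (cases "s \<le> t")
    case True
    have "B0 \<le> s \<or> t \<le> - B0" using that unfolding B_def by linarith
    then show ?thesis using B0 True by blast
  qed simp
  obtain K where K: "\<And>s t. s \<le> t \<Longrightarrow> {s..t} \<subseteq> {-B..B} \<Longrightarrow> \<bar>integral {s..t} f\<bar> \<le> K"
    using compact_interval_integrals_bounded[OF loc] by blast
  have empty: "integral {u..v} f = 0" if "v \<le> u" for u v
    using that by (cases "u = v") simp_all
  have split: "integral {s..t} f = integral {s..min t c} f + integral {max s c..t} f" for s t c
  proof -
    consider "t < s" | "s \<le> t" "c \<le> s" | "s \<le> t" "t \<le> c" | "s \<le> c" "c \<le> t" by linarith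
    then show ?thesis
      by cases (auto simp: min_def max_def empty Henstock_Kurzweil_Integration.integral_combine[OF _ _ loc])
  qed
  \<comment> \<open>Any of the three pieces may be empty; \<open>max K 0\<close> covers an empty central piece.\<close>
  have "\<bar>integral {s..t} f\<bar> \<le> 1 + (max K 0 + 1)" for s t
  proof -
    have "\<bar>integral {max s (-B)..min t B} f\<bar> \<le> max K 0"
      using K[of "max s (-B)" "min t B"] by (cases "max s (-B) \<le> min t B") (auto simp: B_def)
    moreover have "\<bar>integral {s..min t (-B)} f\<bar> \<le> 1" "\<bar>integral {max (max s (-B)) B..t} f\<bar> \<le> 1"
      by (rule tail; simp)+
    ultimately show ?thesis
      using split[of s t "-B"] split[of "max s (-B)" t B] by linarith
  qed
  then show thesis using that by blast
qed

section \<open>Reflection, translation and multiplication on the line\<close>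

lemma has_integral_reflect_translate:
  fixes f :: "real \<Rightarrow> real"
  shows "((\<lambda>t. f (x - t)) has_integral i) {a..b} \<longleftrightarrow> (f has_integral i) {x - b..x - a}"
proof -
  have "((\<lambda>t. f (x - t)) has_integral i) {a..b} \<longleftrightarrow>
      ((\<lambda>t. (f \<circ> (+) x) (- t)) has_integral i) {- (- a)..- (- b)}"
    by (simp only: o_def minus_minus diff_conv_add_uminus)
  also have "\<dots> \<longleftrightarrow> ((f \<circ> (+) x) has_integral i) {- b..- a}"
    by (rule has_integral_reflect_real)
  also have "\<dots> \<longleftrightarrow> (f has_integral i) {- b + x..- a + x}"
    by (rule has_integral_shift_Icc_real)
  finally show ?thesis by (simp only: uminus_add_conv_diff)
qed

lemma integrable_reflect_translate:
  fixes f :: "real \<Rightarrow> real"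
  shows "(\<lambda>t. f (x - t)) integrable_on {a..b} \<longleftrightarrow> f integrable_on {x - b..x - a}"
  by (simp add: integrable_on_def has_integral_reflect_translate)

lemma integral_reflect_translate:
  fixes f :: "real \<Rightarrow> real"
  shows "integral {a..b} (\<lambda>t. f (x - t)) = integral {x - b..x - a} f"
  by (simp add: integral_def integrable_reflect_translate has_integral_reflect_translate)

lemma HK_reflect_translate:
  fixes f :: "real \<Rightarrow> real"
  assumes f: "f integrable_on UNIV"
  shows "(\<lambda>t. f (x - t)) integrable_on UNIV"
  unfolding integrable_on_UNIV_iff_small_tails integrable_reflect_translate integral_reflect_translate
proof (intro conjI allI impI)
  show "f integrable_on {x - t..x - s}" for s t
    using integrable_on_subinterval[OF f] by blast
  fix e :: real assume "e > 0"
  then obtain B where B: "\<And>s t. s \<le> t \<Longrightarrow> B \<le> s \<or> t \<le> - B \<Longrightarrow> \<bar>integral {s..t} f\<bar> \<le> e"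
    using f[unfolded integrable_on_UNIV_iff_small_tails] by blast
  have "\<bar>integral {x - t..x - s} f\<bar> \<le> e" if "s \<le> t" "B + \<bar>x\<bar> \<le> s \<or> t \<le> - (B + \<bar>x\<bar>)" for s t
    using that by (intro B) linarith+
  then show "\<exists>B. \<forall>s t. s \<le> t \<longrightarrow> B \<le> s \<or> t \<le> - B \<longrightarrow> \<bar>integral {x - t..x - s} f\<bar> \<le> e"
    by blast
qed

text \<open>
  On a tail interval the compact estimate bounds the integral of the product by the size of the
  tail integrals of \<open>f\<close> times a constant depending only on \<open>g\<close>, since a function of bounded variation
  stays within its variation of any one of its values.
\<close>

lemma integrable_mult_BV_UNIV:
  fixes f g :: "real \<Rightarrow> real"
  assumes f: "f integrable_on UNIV" and bv: "bounded_variation_on UNIV g"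
  shows "(\<lambda>t. f t * g t) integrable_on UNIV"
  unfolding integrable_on_UNIV_iff_small_tails
proof (intro conjI allI impI)
  have loc: "f integrable_on {s..t}" for s t
    using integrable_on_subinterval[OF f] by blast
  have bv_on: "bounded_variation_on A g" for A
    using bounded_variation_on_subset[OF bv] by blast
  show "(\<lambda>t. f t * g t) integrable_on {s..t}" for s t
  proof (cases "s \<le> t")
    case True
    obtain K where "\<And>u v. u \<le> v \<Longrightarrow> {u..v} \<subseteq> {s..t} \<Longrightarrow> \<bar>integral {u..v} f\<bar> \<le> K"
      using compact_interval_integrals_bounded[OF loc] by blast
    then show ?thesis
      using True by (intro integral_mult_BV_compact(1)[OF loc _ _ bv_on, of _ s]) auto
  next
    case False
    then show ?thesis by (simp add: integrable_on_empty)
  qed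
  define V where "V = variation UNIV g"
  have "0 \<le> V" unfolding V_def by (rule variation_nonneg[OF bv]) simp
  have g_bound: "\<bar>g t\<bar> \<le> \<bar>g 0\<bar> + V" for t
  proof -
    have "\<bar>g (max 0 t) - g (min 0 t)\<bar> \<le> variation {min 0 t..max 0 t} g"
      by (intro abs_diff_le_variation bv_on) simp
    also have "\<dots> \<le> V" unfolding V_def by (intro variation_mono bv) auto
    finally show ?thesis by (auto simp: min_def max_def split: if_splits)
  qed
  fix e :: real assume "e > 0"
  \<comment> \<open>The last summand 1 only keeps the denominator positive.\<close>
  define \<delta> where "\<delta> = e / (\<bar>g 0\<bar> + V + V + 1)"
  have "\<delta> > 0" using \<open>e > 0\<close> \<open>0 \<le> V\<close> by (simp add: \<delta>_def)
  then obtain B where B: "\<And>s t. s \<le> t \<Longrightarrow> B \<le> s \<or> t \<le> - B \<Longrightarrow> \<bar>integral {s..t} f\<bar> \<le> \<delta>"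
    using f[unfolded integrable_on_UNIV_iff_small_tails] by blast
  have "\<bar>integral {s..t} (\<lambda>t. f t * g t)\<bar> \<le> e" if st: "s \<le> t" "B \<le> s \<or> t \<le> - B" for s t
  proof -
    have "\<bar>integral {s..t} (\<lambda>t. f t * g t)\<bar> \<le> \<bar>integral {s..t} f\<bar> * \<bar>g s\<bar> + \<delta> * variation {s..t} g"
      using st by (intro integral_mult_BV_compact(2) loc bv_on B) auto
    also have "\<dots> \<le> \<delta> * (\<bar>g 0\<bar> + V) + \<delta> * V"
      using st \<open>\<delta> > 0\<close> g_bound[of s] B[OF st]
      by (intro add_mono mult_mono mult_left_mono) (auto simp: V_def intro!: variation_mono bv)
    also have "\<dots> \<le> \<delta> * (\<bar>g 0\<bar> + V + V + 1)" using \<open>\<delta> > 0\<close> by (simp add: algebra_simps)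
    also have "\<dots> = e" using \<open>0 \<le> V\<close> by (simp add: \<delta>_def)
    finally show ?thesis .
  qed
  then show "\<exists>B. \<forall>s t. s \<le> t \<longrightarrow> B \<le> s \<or> t \<le> - B \<longrightarrow> \<bar>integral {s..t} (\<lambda>t. f t * g t)\<bar> \<le> e"
    by blast
qed

section \<open>The convolution estimates\<close>

text \<open>The infimum need not be attained, so one divides by \<open>K\<close> before passing to it.\<close>

lemma le_mult_INF_abs_add:
  fixes g :: "'a \<Rightarrow> real"
  assumes "A \<noteq> {}" "0 \<le> K" and le: "\<And>c. c \<in> A \<Longrightarrow> u \<le> K * \<bar>g c\<bar> + v"
  shows "u \<le> K * (INF c\<in>A. \<bar>g c\<bar>) + v"
proof (cases "K = 0")
  case True
  then show ?thesis using assms by auto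
next
  case False
  then have "K > 0" using \<open>0 \<le> K\<close> by simp
  have "(u - v) / K \<le> (INF c\<in>A. \<bar>g c\<bar>)"
    using \<open>A \<noteq> {}\<close>
  proof (rule cINF_greatest)
    show "(u - v) / K \<le> \<bar>g c\<bar>" if "c \<in> A" for c
      using le[OF that] \<open>K > 0\<close> by (simp add: pos_divide_le_eq algebra_simps)
  qed
  then show ?thesis using \<open>K > 0\<close> by (simp add: pos_divide_le_eq algebra_simps)
qed

lemma convolution_HK_BV:
  fixes f g :: "real \<Rightarrow> real"
  assumes "f \<in> HK" "g \<in> BV"
  shows "convolution_exists_at f g x"
    and "\<bar>convolution f g x\<bar> \<le> alexiewicz_norm UNIV f * ((INF t. \<bar>g t\<bar>) + variation UNIV g)"
proof -
  have f: "f integrable_on UNIV" and bv: "bounded_variation_on UNIV g"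
    using assms by (auto simp: HK_def BV_def)
  have bv_on: "bounded_variation_on A g" for A
    using bounded_variation_on_subset[OF bv] by blast
  define F where "F t = f (x - t)" for t
  define M where "M = alexiewicz_norm UNIV f"
  define V where "V = variation UNIV g"
  have F: "F integrable_on UNIV" unfolding F_def by (rule HK_reflect_translate[OF f])
  obtain K where "\<And>s t. s \<le> t \<Longrightarrow> \<bar>integral {s..t} f\<bar> \<le> K"
    using HK_interval_integrals_bounded[OF f] by blast
  then have "\<bar>integral {s..t} f\<bar> \<le> M" for s t
    unfolding M_def by (intro abs_integral_le_alexiewicz_norm) auto
  then have M: "\<bar>integral {s..t} F\<bar> \<le> M" for s t
    unfolding F_def integral_reflect_translate .
  have "0 \<le> M" using M[of 0 0] by simp
  have Fg: "(\<lambda>t. F t * g t) integrable_on UNIV"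
    by (rule integrable_mult_BV_UNIV[OF F bv])
  then show "convolution_exists_at f g x"
    by (simp add: convolution_exists_at_def F_def)
  \<comment> \<open>The symmetric interval must contain \<open>c\<close>, hence the radii from \<open>\<bar>c\<bar>\<close> on.\<close>
  have "\<bar>integral UNIV (\<lambda>t. F t * g t)\<bar> \<le> M * \<bar>g c\<bar> + M * V" for c
  proof (rule abs_integral_UNIV_le[OF Fg, of "\<bar>c\<bar>"])
    fix r assume r: "\<bar>c\<bar> \<le> r"
    have "\<bar>integral {-r..r} (\<lambda>t. F t * g t)\<bar> \<le> \<bar>integral {-r..r} F\<bar> * \<bar>g c\<bar> + M * variation {-r..r} g"
      using r by (intro integral_mult_BV_compact(2) integrable_on_subinterval[OF F] bv_on M) auto
    also have "\<dots> \<le> M * \<bar>g c\<bar> + M * V"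
      using r \<open>0 \<le> M\<close> M by (intro add_mono mult_right_mono mult_left_mono) (auto simp: V_def intro!: variation_mono bv)
    finally show "\<bar>integral {-r..r} (\<lambda>t. F t * g t)\<bar> \<le> M * \<bar>g c\<bar> + M * V" .
  qed
  then have "\<bar>integral UNIV (\<lambda>t. F t * g t)\<bar> \<le> M * (INF c. \<bar>g c\<bar>) + M * V"
    using \<open>0 \<le> M\<close> by (intro le_mult_INF_abs_add) auto
  then show "\<bar>convolution f g x\<bar> \<le> alexiewicz_norm UNIV f * ((INF t. \<bar>g t\<bar>) + variation UNIV g)"
    by (simp add: convolution_def F_def M_def V_def algebra_simps)
qed

lemma convolution_HK_loc_BV:
  fixes f g :: "real \<Rightarrow> real"
  assumes "f \<in> HK_loc" "g \<in> BV" "a \<le> b" and supp: "closure {t. g t \<noteq> 0} \<subseteq> {a..b}"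
  shows "convolution_exists_at f g x"
    and "\<bar>convolution f g x\<bar> \<le> \<bar>integral {x - b..x - a} f\<bar> * (INF t\<in>{a..b}. \<bar>g t\<bar>)
           + alexiewicz_norm {x - b..x - a} f * variation {a..b} g"
proof -
  have f: "f integrable_on {s..t}" for s t
    using assms by (simp add: HK_loc_def)
  have bv: "bounded_variation_on {a..b} g"
    using assms by (auto simp: BV_def intro: bounded_variation_on_subset)
  have g0: "g t = 0" if "t \<notin> {a..b}" for t
    using that supp closure_subset[of "{t. g t \<noteq> 0}"] by blast
  define F where "F t = f (x - t)" for t
  define M where "M = alexiewicz_norm {x - b..x - a} f"
  have F: "F integrable_on {a..b}"
    unfolding F_def by (simp add: integrable_reflect_translate f)
  have F_integral: "integral {a..b} F = integral {x - b..x - a} f"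
    unfolding F_def by (rule integral_reflect_translate)
  have M: "\<bar>integral {s..t} F\<bar> \<le> M" if "a \<le> s" "s \<le> t" "t \<le> b" for s t
  proof -
    obtain K where "\<And>s t. s \<le> t \<Longrightarrow> {s..t} \<subseteq> {x - b..x - a} \<Longrightarrow> \<bar>integral {s..t} f\<bar> \<le> K"
      using compact_interval_integrals_bounded[OF f] by blast
    then show ?thesis
      unfolding F_def M_def integral_reflect_translate using that
      by (intro abs_integral_le_alexiewicz_norm) auto
  qed
  have prod: "(\<lambda>t. F t * g t) integrable_on {a..b}"
    using \<open>a \<le> b\<close> by (intro integral_mult_BV_compact(1)[OF F _ _ bv M, of a]) auto
  have "((\<lambda>t. F t * g t) has_integral integral {a..b} (\<lambda>t. F t * g t)) UNIV"
    by (rule has_integral_on_superset[OF integrable_integral[OF prod]]) (auto simp: g0)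
  then have ex: "(\<lambda>t. F t * g t) integrable_on UNIV"
    and conv: "integral UNIV (\<lambda>t. F t * g t) = integral {a..b} (\<lambda>t. F t * g t)"
    by (auto simp: integral_unique)
  show "convolution_exists_at f g x"
    using ex by (simp add: convolution_exists_at_def F_def)
  have "\<bar>integral {a..b} (\<lambda>t. F t * g t)\<bar>
      \<le> \<bar>integral {a..b} F\<bar> * (INF c\<in>{a..b}. \<bar>g c\<bar>) + M * variation {a..b} g"
    using \<open>a \<le> b\<close> by (intro le_mult_INF_abs_add integral_mult_BV_compact(2)[OF F _ _ bv M]) auto
  then show "\<bar>convolution f g x\<bar> \<le> \<bar>integral {x - b..x - a} f\<bar> * (INF t\<in>{a..b}. \<bar>g t\<bar>)
           + alexiewicz_norm {x - b..x - a} f * variation {a..b} g"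
    unfolding convolution_def F_def[symmetric] conv
    by (simp add: M_def F_integral)
qed

theorem proposition11:
  shows "(\<forall>f\<in>HK. \<forall>g\<in>BV. \<forall>x :: real.
            convolution_exists_at f g x \<and>
            \<bar>convolution f g x\<bar>
              \<le> alexiewicz_norm UNIV f * ((INF t. \<bar>g t\<bar>) + variation UNIV g)) \<and>
         (\<forall>f\<in>HK_loc. \<forall>g\<in>BV. \<forall>a b :: real.
            a \<le> b \<longrightarrow> closure {t. g t \<noteq> 0} \<subseteq> {a..b} \<longrightarrow>
            (\<forall>x :: real.
               convolution_exists_at f g x \<and>
               \<bar>convolution f g x\<bar>
                 \<le> \<bar>integral {x - b..x - a} f\<bar> * (INF t\<in>{a..b}. \<bar>g t\<bar>)
                   + alexiewicz_norm {x - b..x - a} f * variation {a..b} g))"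
  using convolution_HK_BV convolution_HK_loc_BV by blast

end
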